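(* Let $X$ be a Tychonoff space. The following are equivalent: (a) $C_{kh}(X)$ is completely regular; (b) $C_{kh}(X)$ is regular; (c) $lc(X)$ is $G_\delta$-dense in $X$.
   Context: Tychonoff means completely regular and Hausdorff. $C(X)$ is the set of all continuous functions $X\to\mathbb{R}$. For $A\subseteq X$ and $V\subseteq\mathbb{R}$ put $[A,V]^+=\{f\in C(X): f(A)\subseteq V\}$; for $U\subseteq X$ and $r\in\mathbb{R}$ put $[U,r]^-=\{f\in C(X): f^{-1}(r)\cap U\neq\emptyset\}$. The bi-compact-open topology $kh$ on $C(X)$ is the topology with subbase consisting of all $[A,V]^+$ with $A\subseteq X$ compact and $V\subseteq\mathbb{R}$ open, together with all $[U,r]^-$ with $U\subseteq X$ open and $r\in\mathbb{R}$; $C_{kh}(X)$ denotes $C(X)$ with this topology. The set $lc(X)$ consists of all points of $X$ that have a compact neighborhood in $X$. A subset $D\subseteq X$ is $G_\delta$-dense in $X$ if every nonempty $G_\delta$-set in $X$ intersects $D$. *)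

theory Defs
  imports "HOL-Analysis.Analysis"
begin

definition tychonoff_space :: "'a topology \<Rightarrow> bool" where
  "tychonoff_space X \<longleftrightarrow> completely_regular_space X \<and> Hausdorff_space X"

text \<open>Continuous real functions on X; extensionality off the carrier (value undefined there) makes
  each mathematical function on X be represented by exactly one HOL function.\<close>

definition cont_fun :: "'a topology \<Rightarrow> ('a \<Rightarrow> real) set" where
  "cont_fun X = {f \<in> extensional (topspace X). continuous_map X euclideanreal f}"

definition sub_plus :: "'a topology \<Rightarrow> 'a set \<Rightarrow> real set \<Rightarrow> ('a \<Rightarrow> real) set" where
  "sub_plus X A V = {f \<in> cont_fun X. f ` A \<subseteq> V}"

definition sub_minus :: "'a topology \<Rightarrow> 'a set \<Rightarrow> real \<Rightarrow> ('a \<Rightarrow> real) set" where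
  "sub_minus X U r = {f \<in> cont_fun X. f -` {r} \<inter> U \<noteq> {}}"

text \<open>The carrier of the generated topology is the union of its subbase, which is all of
  \<^term>\<open>cont_fun X\<close> because the empty set is compact; see \<open>topspace_C_kh\<close>.\<close>

definition C_kh :: "'a topology \<Rightarrow> ('a \<Rightarrow> real) topology" where
  "C_kh X = topology_generated_by
     ({sub_plus X A V | A V. compactin X A \<and> open V} \<union>
      {sub_minus X U r | U r. openin X U})"

lemma topspace_C_kh: "topspace (C_kh X) = cont_fun X"
proof
  show "topspace (C_kh X) \<subseteq> cont_fun X"
    unfolding C_kh_def topology_generated_by_topspace
    by (auto simp: sub_plus_def sub_minus_def)
  have "cont_fun X = sub_plus X {} UNIV"
    by (simp add: sub_plus_def)
  then have "cont_fun X \<in> {sub_plus X A V | A V. compactin X A \<and> open V}"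
    using compactin_empty[of X] open_UNIV by blast
  then show "cont_fun X \<subseteq> topspace (C_kh X)"
    unfolding C_kh_def topology_generated_by_topspace by (intro Union_upper UnI1)
qed

definition lc :: "'a topology \<Rightarrow> 'a set" where
  "lc X = {x \<in> topspace X. \<exists>K. compactin X K \<and> x \<in> X interior_of K}"

definition gdelta_dense_in :: "'a topology \<Rightarrow> 'a set \<Rightarrow> bool" where
  "gdelta_dense_in X D \<longleftrightarrow>
     D \<subseteq> topspace X \<and> (\<forall>G. gdelta_in X G \<and> G \<noteq> {} \<longrightarrow> G \<inter> D \<noteq> {})"

end

theory Submission
  imports Defs
begin

text \<open>
  A neighbourhood of \<open>f\<close> constrains a function in two ways: it must stay uniformly close to \<open>f\<close> on
  some compact set \<open>A\<close>, and it must take finitely many values \<open>f x\<close> somewhere in prescribed open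
  sets \<open>U\<close> containing \<open>x\<close> (lemma \<open>C_kh_neighbourhood\<close>). The theorem turns on whether the second
  kind of condition is determined by the behaviour on compact sets.

  At a point \<open>x\<close> without compact neighbourhood it is not: every \<open>U\<close> leaves every compact set, so a
  value in \<open>U\<close> can be created without touching the function on a given compact set.
  Suppose a nonempty \<open>G\<close> of type G-delta misses \<open>lc X\<close>. It contains a nonempty zero set of some
  \<open>f \<ge> 0\<close> (lemma \<open>zero_set_in_gdelta\<close>), so \<open>f\<close> lies in \<open>[X, 0]\<^sup>-\<close>. Given any neighbourhood \<open>W\<close> of \<open>f\<close>,
  the function \<open>g = max f d\<close> has no zero, yet for small \<open>d > 0\<close> it meets every condition of \<open>W\<close>
  except those that ask for a zero. Multiplying \<open>g\<close> by a function that is 1 on a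
  large compact set and 0 at finitely many points outside restores these zeros, and leaves \<open>g\<close>
  unchanged wherever a neighbourhood of \<open>g\<close> looks at it. Thus \<open>g\<close> is in the closure of \<open>W\<close>, no closed
  neighbourhood of \<open>f\<close> fits into \<open>[X, 0]\<^sup>-\<close>, and regularity fails.

  If \<open>lc X\<close> is G-delta-dense, then every \<open>f\<close> that takes the value \<open>r\<close> on \<open>U\<close> takes it at a point \<open>y\<close>
  of \<open>U\<close> with a compact neighbourhood \<open>K\<close>, because \<open>U\<close> intersected with the fibre of \<open>r\<close> is of type
  G-delta. With \<open>h\<close> vanishing at \<open>y\<close> and equal to 1 off the interior of \<open>K\<close> within \<open>U\<close>, the
  infimum of 1 and the \<open>h x\<close> with \<open>x \<in> K\<close>, \<open>g x = r\<close>, depends continuously on \<open>g\<close> and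
  separates \<open>f\<close> from the complement of \<open>[U, r]\<^sup>-\<close> (lemma \<open>sub_minus_separation\<close>). The sets
  \<open>[A, V]\<^sup>+\<close> are handled by a supremum over \<open>A\<close> (lemma \<open>sub_plus_separation\<close>), and the maximum of
  separating functions deals with intersections.
\<close>

section \<open>The bi-compact-open topology\<close>

lemma openin_sub_plus: "compactin X A \<Longrightarrow> open V \<Longrightarrow> openin (C_kh X) (sub_plus X A V)"
  unfolding C_kh_def by (rule topology_generated_by_Basis) blast

lemma openin_sub_minus: "openin X U \<Longrightarrow> openin (C_kh X) (sub_minus X U r)"
  unfolding C_kh_def by (rule topology_generated_by_Basis) blast

lemma openin_C_kh_induct [consumes 1, case_names Empty Int Union plus minus]:
  assumes "openin (C_kh X) W"
    and "P {}"
    and "\<And>S T. P S \<Longrightarrow> P T \<Longrightarrow> P (S \<inter> T)"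
    and "\<And>\<K>. (\<And>S. S \<in> \<K> \<Longrightarrow> P S) \<Longrightarrow> P (\<Union>\<K>)"
    and "\<And>A V. compactin X A \<Longrightarrow> open V \<Longrightarrow> P (sub_plus X A V)"
    and "\<And>U r. openin X U \<Longrightarrow> P (sub_minus X U r)"
  shows "P W"
proof -
  have "generate_topology_on ({sub_plus X A V | A V. compactin X A \<and> open V} \<union>
      {sub_minus X U r | U r. openin X U}) W"
    using assms(1) unfolding C_kh_def by (rule openin_topology_generated_by)
  then show ?thesis
  proof induction
    case (UN K)
    show ?case
      by (rule assms(4)) (rule UN.IH)
  qed (use assms in auto)
qed

lemma continuous_map_cont_fun: "f \<in> cont_fun X \<Longrightarrow> continuous_map X euclideanreal f"
  by (simp add: cont_fun_def)

lemma restrict_in_cont_fun: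
  assumes "continuous_map X euclideanreal f"
  shows "restrict f (topspace X) \<in> cont_fun X"
  unfolding cont_fun_def using continuous_map_eq[OF assms, of "restrict f (topspace X)"] by auto

lemma compact_image_cont_fun:
  assumes "compactin X A" "f \<in> cont_fun X"
  shows "compact (f ` A)"
  using image_compactin[OF assms(1) continuous_map_cont_fun[OF assms(2)]] by simp

text \<open>
  The pairs \<open>(x, U)\<close> record, for each subbasic set \<open>[U, r]\<^sup>-\<close> involved, a point where \<open>f\<close> attains
  \<open>r\<close>; the number \<open>r\<close> is then \<open>f x\<close>. The sets \<open>[A, V]\<^sup>+\<close> can be merged into a single compact
  set with a single radius because \<open>f ` A\<close> is compact and so has positive distance from the
  complement of \<open>V\<close>.
\<close>

lemma C_kh_neighbourhood:
  assumes "openin (C_kh X) W" and "f \<in> W"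
  shows "\<exists>A e P. compactin X A \<and> 0 < e \<and> finite P \<and> (\<forall>(x, U) \<in> P. openin X U \<and> x \<in> U) \<and>
           (\<forall>h \<in> cont_fun X. (\<forall>x \<in> A. \<bar>h x - f x\<bar> < e) \<longrightarrow> (\<forall>(x, U) \<in> P. \<exists>y \<in> U. h y = f x)
              \<longrightarrow> h \<in> W)"
  using assms
proof (induction W rule: openin_C_kh_induct)
  case Empty
  then show ?case by simp
next
  case (Int S T)
  from Int.IH(1)[OF IntD1[OF Int.prems]] obtain A e P where 1: "compactin X A" "0 < e" "finite P"
      "\<forall>(x, U) \<in> P. openin X U \<and> x \<in> U"
      "\<forall>h \<in> cont_fun X. (\<forall>x \<in> A. \<bar>h x - f x\<bar> < e) \<longrightarrow> (\<forall>(x, U) \<in> P. \<exists>y \<in> U. h y = f x) \<longrightarrow> h \<in> S"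
    by (elim exE conjE) (rule that, assumption+)
  from Int.IH(2)[OF IntD2[OF Int.prems]] obtain B d Q where 2: "compactin X B" "0 < d" "finite Q"
      "\<forall>(x, U) \<in> Q. openin X U \<and> x \<in> U"
      "\<forall>h \<in> cont_fun X. (\<forall>x \<in> B. \<bar>h x - f x\<bar> < d) \<longrightarrow> (\<forall>(x, U) \<in> Q. \<exists>y \<in> U. h y = f x) \<longrightarrow> h \<in> T"
    by (elim exE conjE) (rule that, assumption+)
  show ?case
    by (rule exI[of _ "A \<union> B"], rule exI[of _ "min e d"], rule exI[of _ "P \<union> Q"])
      (use 1 2 in \<open>auto simp: compactin_Un ball_Un\<close>)
next
  case (Union \<K>)
  then obtain S where S: "S \<in> \<K>" "f \<in> S" by blast
  from Union.IH[OF S(1) S(2)] obtain A e P where "compactin X A" "0 < e" "finite P"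
      "\<forall>(x, U) \<in> P. openin X U \<and> x \<in> U"
      "\<forall>h \<in> cont_fun X. (\<forall>x \<in> A. \<bar>h x - f x\<bar> < e) \<longrightarrow> (\<forall>(x, U) \<in> P. \<exists>y \<in> U. h y = f x) \<longrightarrow> h \<in> S"
    by (elim exE conjE) (rule that, assumption+)
  then show ?case using S(1)
    by (intro exI[of _ A] exI[of _ e] exI[of _ P]) blast
next
  case (plus A V)
  then have f: "f \<in> cont_fun X" "f ` A \<subseteq> V" by (auto simp: sub_plus_def)
  obtain e where e: "e > 0" "(\<Union>t \<in> f ` A. ball t e) \<subseteq> V"
    using compact_subset_open_imp_ball_epsilon_subset
      [OF compact_image_cont_fun[OF plus(1) f(1)] plus(2) f(2)] by metis
  have "h \<in> sub_plus X A V" if "h \<in> cont_fun X" "\<forall>x \<in> A. \<bar>h x - f x\<bar> < e" for h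
  proof -
    have "h x \<in> ball (f x) e" if "x \<in> A" for x
      using \<open>\<forall>x \<in> A. \<bar>h x - f x\<bar> < e\<close> that by (auto simp: dist_real_def abs_minus_commute)
    then have "h x \<in> V" if "x \<in> A" for x using e(2) that by blast
    then show ?thesis using that(1) by (auto simp: sub_plus_def)
  qed
  then show ?case
    by (intro exI[of _ A] exI[of _ e] exI[of _ "{}"]) (use plus e in auto)
next
  case (minus U r)
  then obtain x where "x \<in> U" "f x = r" by (auto simp: sub_minus_def)
  then show ?case
    by (intro exI[of _ "{}"] exI[of _ 1] exI[of _ "{(x, U)}"])
      (use minus in \<open>auto simp: sub_minus_def\<close>)
qed

section \<open>Zero sets in completely regular spaces\<close>

lemma completely_regular_bump:
  assumes "completely_regular_space X" "openin X U" "x \<in> U"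
  obtains p where "continuous_map X (top_of_set {0..1::real}) p" "p x = 0" "p ` (topspace X - U) \<subseteq> {1}"
proof -
  have "closedin X (topspace X - U)" "x \<in> topspace X - (topspace X - U)"
    using assms(2,3) openin_subset by auto
  then show ?thesis
    using assms(1) that unfolding completely_regular_space_def by blast
qed

text \<open>
  If \<open>G\<close> is the intersection of the open sets \<open>C n\<close>, the sum of \<open>(1/2)\<^sup>n * p n\<close>, with \<open>p n\<close> vanishing
  at \<open>x\<close> and equal to 1 off \<open>C n\<close>, converges uniformly and is positive off \<open>G\<close>.
\<close>

lemma zero_set_in_gdelta:
  assumes cr: "completely_regular_space X" and G: "gdelta_in X G" and x: "x \<in> G"
  obtains f where "continuous_map X euclideanreal f" "f x = 0"
    "\<And>y. y \<in> topspace X \<Longrightarrow> 0 \<le> f y" "\<And>y. y \<in> topspace X \<Longrightarrow> f y = 0 \<Longrightarrow> y \<in> G"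
proof -
  obtain C where C: "\<And>n::nat. openin X (C n)" "\<Inter>(range C) = G"
    using G unfolding gdelta_in_descending by blast
  have xC: "x \<in> C n" for n using C(2) x by blast
  have "\<exists>p. continuous_map X (top_of_set {0..1::real}) p \<and> p x = 0 \<and> p ` (topspace X - C n) \<subseteq> {1}" for n
    using completely_regular_bump[OF cr C(1) xC] by blast
  then obtain p where p: "\<And>n. continuous_map X (top_of_set {0..1::real}) (p n)" "\<And>n. p n x = 0"
      "\<And>n. p n ` (topspace X - C n) \<subseteq> {1}"
    by metis
  have pc: "continuous_map X euclideanreal (p n)" and p01: "y \<in> topspace X \<Longrightarrow> p n y \<in> {0..1}" for n y
    using p(1)[of n] by (auto simp: continuous_map_in_subtopology)
  define f where "f = (\<lambda>y. \<Sum>n. (1/2)^n * p n y)"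
  have bound: "norm ((1/2)^n * p n y) \<le> (1/2)^n" if "y \<in> topspace X" for n y
    using p01[OF that, of n] by (simp add: abs_mult mult_left_le)
  have summ: "summable (\<lambda>n. (1/2)^n * p n y)" if "y \<in> topspace X" for y
    by (rule summable_comparison_test'[of "\<lambda>n. (1/2)^n" 0]) (use bound[OF that] in auto)
  have ul: "uniform_limit (topspace X) (\<lambda>n y. \<Sum>i<n. (1/2)^i * p i y) f sequentially"
    unfolding f_def by (rule Weierstrass_m_test[OF bound]) auto
  have "continuous_map X euclideanreal f"
  proof -
    have "continuous_map X Met_TC.mtopology f"
    proof (rule Met_TC.continuous_map_uniform_limit
        [where f = "\<lambda>n y. \<Sum>i<n. (1/2)^i * p i y" and F = sequentially])
      show "\<forall>\<^sub>F n in sequentially. continuous_map X Met_TC.mtopology (\<lambda>y. \<Sum>i<n. (1/2)^i * p i y)"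
        by (intro always_eventually allI) (auto intro!: continuous_intros pc)
      show "\<forall>\<^sub>F n in sequentially. \<forall>y\<in>topspace X. f y \<in> UNIV \<and> dist (\<Sum>i<n. (1/2)^i * p i y) (f y) < d"
        if "0 < d" for d
        using ul that unfolding uniform_limit_iff by auto
    qed simp
    then show ?thesis by simp
  qed
  moreover have "f x = 0" by (simp add: f_def p(2))
  moreover have "0 \<le> f y" if "y \<in> topspace X" for y
    unfolding f_def by (rule suminf_nonneg[OF summ[OF that]]) (use p01[OF that] in auto)
  moreover have "y \<in> G" if y: "y \<in> topspace X" "f y = 0" for y
  proof -
    have "\<forall>n. (1/2)^n * p n y = 0"
    proof -
      have "0 \<le> (1/2)^n * p n y" for n using p01[OF y(1), of n] by simp
      then show ?thesis
        using suminf_eq_zero_iff[OF summ[OF y(1)]] y(2) unfolding f_def by blast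
    qed
    then have p0: "p n y = 0" for n by simp
    have "y \<in> C n" for n
    proof (rule ccontr)
      assume "y \<notin> C n"
      then have "p n y = 1" using p(3)[of n] y(1) by blast
      with p0 show False by simp
    qed
    then show ?thesis using C(2) by blast
  qed
  ultimately show ?thesis using that by blast
qed

section \<open>Regularity forces the locally compact points to be dense\<close>

lemma not_lc_imp_open_not_subset_compact:
  assumes "x \<notin> lc X" "openin X U" "x \<in> U" "compactin X B"
  shows "\<exists>z \<in> U. z \<notin> B"
proof (rule ccontr)
  assume "\<not> (\<exists>z \<in> U. z \<notin> B)"
  then have "x \<in> X interior_of B"
    using assms(2,3) by (auto simp: interior_of_def)
  then have "x \<in> lc X"
    using assms unfolding lc_def by (auto dest: openin_subset)
  with assms(1) show False by simp
qed

lemma regular_imp_gdelta_dense_lc: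
  assumes X: "tychonoff_space X" and reg: "regular_space (C_kh X)"
  shows "gdelta_dense_in X (lc X)"
proof (rule ccontr)
  have cr: "completely_regular_space X" and H: "Hausdorff_space X"
    using X by (auto simp: tychonoff_space_def)
  assume "\<not> gdelta_dense_in X (lc X)"
  then obtain G x where G: "gdelta_in X G" "x \<in> G" "G \<inter> lc X = {}"
    unfolding gdelta_dense_in_def by (auto simp: lc_def)
  have xX: "x \<in> topspace X" using G gdelta_in_subset by blast
  obtain f0 where f0: "continuous_map X euclideanreal f0" "f0 x = 0"
    "\<And>y. y \<in> topspace X \<Longrightarrow> 0 \<le> f0 y" "\<And>y. y \<in> topspace X \<Longrightarrow> f0 y = 0 \<Longrightarrow> y \<in> G"
    using zero_set_in_gdelta[OF cr G(1,2)] by metis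
  define f where "f = restrict f0 (topspace X)"
  have f: "f \<in> cont_fun X" "f x = 0" "\<And>y. y \<in> topspace X \<Longrightarrow> 0 \<le> f y"
      "\<And>y. y \<in> topspace X \<Longrightarrow> f y = 0 \<Longrightarrow> y \<notin> lc X"
    using restrict_in_cont_fun[OF f0(1)] f0 xX G(3) by (auto simp: f_def)
  have "f \<in> sub_minus X (topspace X) 0"
    using f xX by (auto simp: sub_minus_def)
  then have "\<exists>W F. openin (C_kh X) W \<and> closedin (C_kh X) F \<and> f \<in> W \<and> W \<subseteq> F \<and>
      F \<subseteq> sub_minus X (topspace X) 0"
    using reg openin_sub_minus[OF openin_topspace]
    unfolding neighbourhood_base_of_closedin[symmetric] neighbourhood_base_of by meson
  then obtain W F where W: "openin (C_kh X) W" "closedin (C_kh X) F" "f \<in> W" "W \<subseteq> F"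
      "F \<subseteq> sub_minus X (topspace X) 0"
    by blast
  obtain A e P where nf: "compactin X A" "0 < e" "finite P"
      "\<forall>(x, U) \<in> P. openin X U \<and> x \<in> U"
      "\<forall>h \<in> cont_fun X. (\<forall>x \<in> A. \<bar>h x - f x\<bar> < e) \<longrightarrow> (\<forall>(x, U) \<in> P. \<exists>y \<in> U. h y = f x) \<longrightarrow> h \<in> W"
    using C_kh_neighbourhood[OF W(1,3)] by (elim exE conjE) (rule that, assumption+)
  have PX: "fst q \<in> topspace X" if "q \<in> P" for q
    using nf(4) that openin_subset by fastforce
  \<comment> \<open>Raising \<open>f\<close> to at least \<open>d\<close> moves it by less than \<open>e\<close> and keeps the nonzero values that the
     pairs in \<open>P\<close> ask for.\<close>
  define d where "d = Min (insert (e/2) (f ` fst ` {q \<in> P. f (fst q) \<noteq> 0}))"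
  have fin: "finite (insert (e/2) (f ` fst ` {q \<in> P. f (fst q) \<noteq> 0}))" using nf(3) by simp
  have d0: "0 < d"
    unfolding d_def using fin nf(2) f(3)[OF PX] by (subst Min_gr_iff) force+
  have de: "d < e" using Min_le[OF fin, of "e/2"] nf(2) unfolding d_def by simp
  have dP: "d \<le> f (fst q)" if "q \<in> P" "f (fst q) \<noteq> 0" for q
    unfolding d_def by (rule Min_le[OF fin]) (use that in auto)
  define g where "g = restrict (\<lambda>y. max (f y) d) (topspace X)"
  have gc: "g \<in> cont_fun X"
    unfolding g_def by (intro restrict_in_cont_fun continuous_intros continuous_map_cont_fun f(1)) simp
  have gf: "\<bar>g y - f y\<bar> < e" if "y \<in> topspace X" for y
    using that f(3)[OF that] d0 de by (auto simp: g_def)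
  have gpos: "0 < g y" if "y \<in> topspace X" for y using that d0 by (auto simp: g_def)
  have "g \<in> C_kh X closure_of W"
    unfolding in_closure_of
  proof (intro conjI allI impI)
    show "g \<in> topspace (C_kh X)" using gc by (simp add: topspace_C_kh)
    fix T assume T: "g \<in> T \<and> openin (C_kh X) T"
    then obtain B b Q where ng: "compactin X B" "0 < b" "finite Q"
      "\<forall>(x, U) \<in> Q. openin X U \<and> x \<in> U"
      "\<forall>h \<in> cont_fun X. (\<forall>x \<in> B. \<bar>h x - g x\<bar> < b) \<longrightarrow> (\<forall>(x, U) \<in> Q. \<exists>y \<in> U. h y = g x) \<longrightarrow> h \<in> T"
      using C_kh_neighbourhood[OF conjunct2[OF T] conjunct1[OF T]]
      by (elim exE conjE) (rule that, assumption+)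
    have QX: "fst ` Q \<subseteq> topspace X"
      using ng(4) openin_subset by fastforce
    define K where "K = A \<union> B \<union> fst ` P \<union> fst ` Q"
    have K: "compactin X K"
      unfolding K_def using PX
      by (intro compactin_Un nf(1) ng(1) finite_imp_compactin QX finite_imageI nf(3) ng(3)) auto
    \<comment> \<open>Where \<open>f\<close> vanishes, \<open>x\<close> has no compact neighbourhood, so there is room outside \<open>K\<close> to
       create the required zero.\<close>
    define P0 where "P0 = {q \<in> P. f (fst q) = 0}"
    have "\<exists>z \<in> snd q. z \<notin> K" if "q \<in> P0" for q
    proof -
      have q: "q \<in> P" "f (fst q) = 0" using that by (auto simp: P0_def)
      show ?thesis
        by (rule not_lc_imp_open_not_subset_compact[OF f(4)[OF PX[OF q(1)] q(2)] _ _ K])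
          (use nf(4) q in auto)
    qed
    then obtain z where z: "\<And>q. q \<in> P0 \<Longrightarrow> z q \<in> snd q \<and> z q \<notin> K" by metis
    have zX: "z ` P0 \<subseteq> topspace X"
      using z nf(4) openin_subset unfolding P0_def by fastforce
    have zc: "compactin X (z ` P0)"
      by (rule finite_imp_compactin[OF zX]) (use nf(3) in \<open>simp add: P0_def\<close>)
    have "disjnt K (z ` P0)" using z by (auto simp: disjnt_def)
    then obtain u where u: "continuous_map X (top_of_set {0..1::real}) u"
        "u ` (z ` P0) \<subseteq> {0}" "u ` K \<subseteq> {1}"
      using Urysohn_completely_regular_closed_compact[OF _ cr compactin_imp_closedin[OF H K] zc, of 0 1]
      by auto
    define h where "h = restrict (\<lambda>y. g y * u y) (topspace X)"
    have hc: "h \<in> cont_fun X"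
      unfolding h_def using u(1) continuous_map_cont_fun[OF gc]
      by (intro restrict_in_cont_fun continuous_intros)
        (simp_all add: continuous_map_in_subtopology)
    have KX: "K \<subseteq> topspace X" using K compactin_subset_topspace by blast
    have hK: "h y = g y" if "y \<in> K" for y
      using that KX u(3) by (auto simp: h_def)
    have hz: "h (z q) = 0" if "q \<in> P0" for q
      using that zX u(2) by (auto simp: h_def)
    have "h \<in> W"
    proof (rule nf(5)[rule_format, OF hc])
      show "\<bar>h y - f y\<bar> < e" if "y \<in> A" for y
        using that hK[of y] gf[of y] KX by (auto simp: K_def)
      show "case q of (x, U) \<Rightarrow> \<exists>y \<in> U. h y = f x" if q: "q \<in> P" for q
      proof (cases "f (fst q) = 0")
        case True
        then have "q \<in> P0" using q by (simp add: P0_def)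
        then show ?thesis using z[of q] hz[of q] True by (auto simp: split_beta)
      next
        case False
        have "h (fst q) = g (fst q)" using q by (intro hK) (auto simp: K_def)
        also have "\<dots> = f (fst q)"
          using dP[OF q False] PX[OF q] by (auto simp: g_def)
        finally show ?thesis using nf(4) q by (auto simp: split_beta)
      qed
    qed
    moreover have "h \<in> T"
    proof (rule ng(5)[rule_format, OF hc])
      show "\<bar>h y - g y\<bar> < b" if "y \<in> B" for y
        using that hK[of y] ng(2) by (auto simp: K_def)
      show "case q of (x, U) \<Rightarrow> \<exists>y \<in> U. h y = g x" if q: "q \<in> Q" for q
      proof -
        have "h (fst q) = g (fst q)" using q by (intro hK) (auto simp: K_def)
        then show ?thesis using ng(4) q by (auto simp: split_beta)
      qed
    qed
    ultimately show "\<exists>h. h \<in> W \<and> h \<in> T" by blast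
  qed
  then have "g \<in> F" using W by (meson closure_of_minimal subsetD)
  then have "g \<in> sub_minus X (topspace X) 0" using W(5) by blast
  then show False using gpos by (force simp: sub_minus_def)
qed

section \<open>Density of the locally compact points yields complete regularity\<close>

text \<open>
  For \<open>\<psi>\<close> vanishing on \<open>f ` A\<close> and equal to 1 off \<open>V\<close>, take \<open>\<phi> g = Sup (\<psi> ` g ` A)\<close>. Its strict sublevel
  sets are of the form \<open>[A, V']\<^sup>+\<close>, since the supremum is attained, and its strict superlevel sets
  are unions of sets \<open>[{x}, V']\<^sup>+\<close>.
\<close>

lemma sub_plus_separation:
  assumes A: "compactin X A" and V: "open V" and f: "f \<in> sub_plus X A V"
  shows "\<exists>\<phi>. continuous_map (C_kh X) euclideanreal \<phi> \<and> \<phi> f = 0 \<and>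
           \<phi> ` (topspace (C_kh X) - sub_plus X A V) \<subseteq> {1}"
\<comment> \<open>For empty \<open>A\<close> the supremum is taken over the empty set and has no useful value.\<close>
proof (cases "A = {}")
  case True
  then show ?thesis
    by (intro exI[of _ "\<lambda>_. 0"]) (auto simp: sub_plus_def topspace_C_kh)
next
  case False
  have fc: "f \<in> cont_fun X" and fV: "f ` A \<subseteq> V" using f by (auto simp: sub_plus_def)
  have "completely_regular_space euclideanreal"
    using Met_TC.completely_regular_space_mtopology by simp
  then obtain \<psi> where \<psi>: "continuous_map euclideanreal (top_of_set {0..1::real}) \<psi>"
      "\<psi> ` (f ` A) \<subseteq> {0}" "\<psi> ` (- V) \<subseteq> {1}"
    using Urysohn_completely_regular_closed_compact[of 0 1 euclideanreal "- V" "f ` A"]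
      compact_image_cont_fun[OF A fc] V fV
    by (force simp: disjnt_def)
  have \<psi>c: "continuous_on UNIV \<psi>" and \<psi>01: "\<psi> t \<in> {0..1}" for t
    using \<psi>(1) by (auto simp: continuous_map_in_subtopology)
  define \<phi> where "\<phi> g = Sup (\<psi> ` g ` A)" for g :: "'a \<Rightarrow> real"
  have comp: "compact (\<psi> ` g ` A)" if "g \<in> cont_fun X" for g
    by (rule compact_continuous_image[OF continuous_on_subset[OF \<psi>c]])
      (use compact_image_cont_fun[OF A that] in auto)
  have ne: "\<psi> ` g ` A \<noteq> {}" and bdd: "bdd_above (\<psi> ` g ` A)" for g
    using False \<psi>01 by (auto intro: bdd_aboveI[of _ 1])
  have less: "\<phi> g < t \<longleftrightarrow> (\<forall>x \<in> A. \<psi> (g x) < t)" if "g \<in> cont_fun X" for g t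
  proof
    show "\<phi> g < t \<Longrightarrow> \<forall>x \<in> A. \<psi> (g x) < t"
      unfolding \<phi>_def using cSup_upper[OF _ bdd[of g]] by (auto simp: image_iff intro: le_less_trans)
    have "\<phi> g \<in> \<psi> ` g ` A"
      unfolding \<phi>_def by (rule closed_contains_Sup[OF ne bdd compact_imp_closed[OF comp[OF that]]])
    then show "\<forall>x \<in> A. \<psi> (g x) < t \<Longrightarrow> \<phi> g < t" by auto
  qed
  have greater: "t < \<phi> g \<longleftrightarrow> (\<exists>x \<in> A. t < \<psi> (g x))" for g t
    unfolding \<phi>_def less_cSup_iff[OF ne bdd] by auto
  have "continuous_map (C_kh X) euclideanreal \<phi>"
    unfolding continuous_map_upper_lower_semicontinuous_lt
  proof (intro conjI allI)
    fix t
    have "{g \<in> topspace (C_kh X). \<phi> g < t} = sub_plus X A (\<psi> -` {..<t})"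
      by (force simp: topspace_C_kh sub_plus_def less)
    moreover have "open (\<psi> -` {..<t})"
      using \<psi>c by (auto intro: open_vimage)
    ultimately show "openin (C_kh X) {g \<in> topspace (C_kh X). \<phi> g < t}"
      using openin_sub_plus[OF A] by simp
    have "{g \<in> topspace (C_kh X). t < \<phi> g} = (\<Union>x \<in> A. sub_plus X {x} (\<psi> -` {t<..}))"
      by (auto simp: topspace_C_kh sub_plus_def greater)
    moreover have "openin (C_kh X) (sub_plus X {x} (\<psi> -` {t<..}))" if "x \<in> A" for x
    proof (rule openin_sub_plus)
      show "compactin X {x}" using that compactin_subset_topspace[OF A] by auto
      show "open (\<psi> -` {t<..})" using \<psi>c by (auto intro: open_vimage)
    qed
    then have "openin (C_kh X) (\<Union>x \<in> A. sub_plus X {x} (\<psi> -` {t<..}))"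
      by (intro openin_Union) blast
    ultimately show "openin (C_kh X) {g \<in> topspace (C_kh X). t < \<phi> g}"
      by (simp only:)
  qed
  moreover have "\<phi> f = 0"
  proof -
    have "\<psi> ` f ` A = {0}" 
      using subset_singletonD[OF \<psi>(2)] False by simp
    then show ?thesis by (simp add: \<phi>_def)
  qed
  moreover have "\<phi> g = 1" if g: "g \<in> topspace (C_kh X) - sub_plus X A V" for g
  proof -
    obtain x where x: "x \<in> A" "g x \<notin> V" using g by (auto simp: sub_plus_def topspace_C_kh)
    have "\<psi> (g x) = 1" using \<psi>(3) x by auto
    then have "1 \<in> \<psi> ` g ` A" using x(1) by (metis imageI)
    then have "1 \<le> \<phi> g" unfolding \<phi>_def by (rule cSup_upper[OF _ bdd])
    moreover have "\<phi> g \<le> 1" unfolding \<phi>_def by (rule cSup_least[OF ne]) (use \<psi>01 in auto)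
    ultimately show ?thesis by simp
  qed
  ultimately show ?thesis by blast
qed

text \<open>
  The set of points of \<open>U\<close> where \<open>f\<close> equals \<open>r\<close> is a nonempty set of type G-delta, so it contains a
  point \<open>y\<close> with a compact neighbourhood \<open>K\<close>. Let \<open>\<phi> g\<close> measure by \<open>h\<close> how close to \<open>y\<close> the value \<open>r\<close> is
  attained by \<open>g\<close> in \<open>K\<close>, cut off at 1. For \<open>t \<le> 1\<close>, \<open>\<phi> g < t\<close> says that \<open>g\<close> attains \<open>r\<close> on
  an open set; for \<open>t < 1\<close>, \<open>t < \<phi> g\<close> says that \<open>g\<close> omits \<open>r\<close> on the compact set of points of \<open>K\<close> with \<open>h x \<le> t\<close>,
  because compactness makes the infimum a minimum.
\<close>

lemma sub_minus_separation:
  assumes X: "tychonoff_space X" and D: "gdelta_dense_in X (lc X)"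
    and U: "openin X U" and f: "f \<in> sub_minus X U r"
  shows "\<exists>\<phi>. continuous_map (C_kh X) euclideanreal \<phi> \<and> \<phi> f = 0 \<and>
           \<phi> ` (topspace (C_kh X) - sub_minus X U r) \<subseteq> {1}"
proof -
  have cr: "completely_regular_space X" and H: "Hausdorff_space X"
    using X by (auto simp: tychonoff_space_def)
  have fc: "continuous_map X euclideanreal f"
    using f by (auto simp: sub_minus_def cont_fun_def)
  have UX: "U \<subseteq> topspace X" using U openin_subset by blast
  have "gdelta_in X {x \<in> topspace X. f x \<in> {r}}"
  proof -
    have "{x \<in> topspace X. f x \<in> {r}} = (\<Inter>n::nat. {x \<in> topspace X. f x \<in> ball r (1 / Suc n)})"
    proof (intro equalityI subsetI)
      fix x assume x: "x \<in> (\<Inter>n::nat. {x \<in> topspace X. f x \<in> ball r (1 / Suc n)})"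
      then have *: "dist r (f x) < 1 / Suc n" for n :: nat by auto
      have "\<not> 0 < dist r (f x)"
      proof
        assume "0 < dist r (f x)"
        then obtain n where "1 / Suc n < dist r (f x)"
          using nat_approx_posE by blast
        with *[of n] show False by simp
      qed
      then have "f x = r" by simp
      with x show "x \<in> {x \<in> topspace X. f x \<in> {r}}" by auto
    qed auto
    moreover have "gdelta_in X (\<Inter>n::nat. {x \<in> topspace X. f x \<in> ball r (1 / Suc n)})"
      by (intro gdelta_in_Inter)
        (auto intro!: open_imp_gdelta_in openin_continuous_map_preimage[OF fc] simp del: mem_ball)
    ultimately show ?thesis by simp
  qed
  then have "gdelta_in X ({x \<in> topspace X. f x \<in> {r}} \<inter> U)"
    using gdelta_in_Int open_imp_gdelta_in[OF U] by blast
  moreover have "{x \<in> topspace X. f x \<in> {r}} \<inter> U \<noteq> {}"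
    using f UX by (auto simp: sub_minus_def)
  ultimately obtain y where y: "f y = r" "y \<in> U" "y \<in> lc X"
    using D unfolding gdelta_dense_in_def by blast
  then obtain K where K: "compactin X K" "y \<in> X interior_of K" by (auto simp: lc_def)
  define N where "N = X interior_of K \<inter> U"
  have N: "openin X N" "y \<in> N" "N \<subseteq> K" "N \<subseteq> U"
    using U y K interior_of_subset[of X K] by (auto simp: N_def)
  obtain h where h: "continuous_map X (top_of_set {0..1::real}) h" "h y = 0"
      "h ` (topspace X - N) \<subseteq> {1}"
    using completely_regular_bump[OF cr N(1,2)] by blast
  have hc: "continuous_map X euclideanreal h" and h01: "x \<in> topspace X \<Longrightarrow> h x \<in> {0..1}" for x
    using h(1) by (auto simp: continuous_map_in_subtopology)
  have KX: "K \<subseteq> topspace X" using K compactin_subset_topspace by blast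
  have hN: "x \<in> N" if "x \<in> topspace X" "h x < 1" for x
    using h(3) that by force
  \<comment> \<open>Inserting 1 keeps the set nonempty, so that a function missing \<open>r\<close> on \<open>K\<close> gets infimum 1.\<close>
  define S where "S g = insert 1 (h ` {x \<in> K. g x = r})" for g
  define \<phi> where "\<phi> g = Inf (S g)" for g
  have bdd: "bdd_below (S g)" for g
    using h01 KX by (auto simp: S_def intro!: bdd_belowI[of _ 0])
  have ne: "S g \<noteq> {}" for g by (simp add: S_def)
  have comp: "compact (S g)" if "g \<in> cont_fun X" for g
  proof -
    have "closedin X {x \<in> topspace X. g x \<in> {r}}"
      by (rule closedin_continuous_map_preimage[OF continuous_map_cont_fun[OF that]]) simp
    then have "compactin X (K \<inter> {x \<in> topspace X. g x \<in> {r}})"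
      by (rule compact_Int_closedin[OF K(1)])
    moreover have "K \<inter> {x \<in> topspace X. g x \<in> {r}} = {x \<in> K. g x = r}"
      using KX by auto
    ultimately have "compactin euclideanreal (h ` {x \<in> K. g x = r})"
      using image_compactin[OF _ hc] by metis
    then show ?thesis unfolding S_def by (simp add: compact_insert)
  qed
  have less: "\<phi> g < t \<longleftrightarrow> (\<exists>s \<in> S g. s < t)" for g t
    unfolding \<phi>_def by (rule cInf_less_iff[OF ne bdd])
  have greater: "t < \<phi> g \<longleftrightarrow> (\<forall>s \<in> S g. t < s)" if "g \<in> cont_fun X" for g t
  proof
    show "t < \<phi> g \<Longrightarrow> \<forall>s \<in> S g. t < s"
      unfolding \<phi>_def using cInf_lower[OF _ bdd[of g]] by (auto intro: less_le_trans)
    have "\<phi> g \<in> S g"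
      unfolding \<phi>_def by (rule closed_contains_Inf[OF ne bdd compact_imp_closed[OF comp[OF that]]])
    then show "\<forall>s \<in> S g. t < s \<Longrightarrow> t < \<phi> g" by auto
  qed
  have "continuous_map (C_kh X) euclideanreal \<phi>"
    unfolding continuous_map_upper_lower_semicontinuous_lt
  proof (intro conjI allI)
    fix t
    show "openin (C_kh X) {g \<in> topspace (C_kh X). \<phi> g < t}"
    proof (cases "1 < t")
      case True
      then have "{g \<in> topspace (C_kh X). \<phi> g < t} = topspace (C_kh X)"
        by (auto simp: less S_def)
      then show ?thesis by simp
    next
      case False
      let ?U = "N \<inter> {x \<in> topspace X. h x \<in> {..<t}}"
      have "{g \<in> topspace (C_kh X). \<phi> g < t} = sub_minus X ?U r"
      proof (intro equalityI subsetI)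
        fix g assume "g \<in> {g \<in> topspace (C_kh X). \<phi> g < t}"
        then obtain x where "g \<in> cont_fun X" "x \<in> K" "g x = r" "h x < t"
          using False by (auto simp: less S_def topspace_C_kh)
        then show "g \<in> sub_minus X ?U r"
          using hN[of x] False KX by (auto simp: sub_minus_def)
      next
        fix g assume "g \<in> sub_minus X ?U r"
        then show "g \<in> {g \<in> topspace (C_kh X). \<phi> g < t}"
          using N(3) by (auto simp: less S_def topspace_C_kh sub_minus_def)
      qed
      moreover have "openin X ?U"
        by (intro openin_Int N(1) openin_continuous_map_preimage[OF hc]) simp
      ultimately show ?thesis using openin_sub_minus by simp
    qed
    show "openin (C_kh X) {g \<in> topspace (C_kh X). t < \<phi> g}"
    proof (cases "t < 1")
      case False
      then have "{g \<in> topspace (C_kh X). t < \<phi> g} = {}"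
        by (auto simp: greater S_def topspace_C_kh)
      then show ?thesis by (simp only: openin_empty)
    next
      case True
      let ?A = "K \<inter> {x \<in> topspace X. h x \<in> {..t}}"
      have "{g \<in> topspace (C_kh X). t < \<phi> g} = sub_plus X ?A (- {r})"
        using True KX by (force simp: greater S_def topspace_C_kh sub_plus_def)
      moreover have "compactin X ?A"
        by (intro compact_Int_closedin[OF K(1)] closedin_continuous_map_preimage[OF hc]) simp
      ultimately show ?thesis using openin_sub_plus[of X ?A "- {r}"] by (simp add: open_Compl)
    qed
  qed
  moreover have "\<phi> f = 0"
  proof -
    have "0 \<in> S f" using y(1) h(2) N(2,3) by (force simp: S_def)
    then show ?thesis
      unfolding \<phi>_def using h01 KX by (intro cInf_eq_minimum) (auto simp: S_def)
  qed
  moreover have "\<phi> g = 1" if g: "g \<in> topspace (C_kh X) - sub_minus X U r" for g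
  proof -
    have "h x = 1" if "x \<in> K" "g x = r" for x
    proof -
      have "x \<notin> U" using g that by (auto simp: sub_minus_def topspace_C_kh)
      then show ?thesis using h(3) N(4) KX that(1) by auto
    qed
    then have "S g = {1}" by (auto simp: S_def)
    then show ?thesis by (simp add: \<phi>_def)
  qed
  ultimately show ?thesis by blast
qed

lemma gdelta_dense_lc_imp_completely_regular:
  assumes X: "tychonoff_space X" and D: "gdelta_dense_in X (lc X)"
  shows "completely_regular_space (C_kh X)"
  unfolding completely_regular_space_alt'
proof (intro allI impI)
  fix W f
  assume "openin (C_kh X) W" "f \<in> W"
  then show "\<exists>\<phi>. continuous_map (C_kh X) euclideanreal \<phi> \<and> \<phi> f = 0 \<and> \<phi> ` (topspace (C_kh X) - W) \<subseteq> {1}"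
  proof (induction W rule: openin_C_kh_induct)
    case Empty
    then show ?case by simp
  next
    case (Int S T)
    then obtain \<phi> \<psi> where 1: "continuous_map (C_kh X) euclideanreal \<phi>" "\<phi> f = 0"
        "\<phi> ` (topspace (C_kh X) - S) \<subseteq> {1}"
      and 2: "continuous_map (C_kh X) euclideanreal \<psi>" "\<psi> f = 0"
        "\<psi> ` (topspace (C_kh X) - T) \<subseteq> {1}"
      by auto
    \<comment> \<open>Outside \<open>S \<inter> T\<close> one of the two functions is 1, but nothing bounds the other one there; hence
       the cut-off at 1.\<close>
    let ?\<chi> = "\<lambda>g. min 1 (max (\<phi> g) (\<psi> g))"
    have "continuous_map (C_kh X) euclideanreal ?\<chi>"
      by (intro continuous_intros 1 2) simp
    moreover have "?\<chi> ` (topspace (C_kh X) - S \<inter> T) \<subseteq> {1}"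
      using 1(3) 2(3) by fastforce
    ultimately show ?case
      by (intro exI[of _ ?\<chi>]) (use 1(2) 2(2) in simp)
  next
    case (Union \<K>)
    then obtain S where S: "S \<in> \<K>" "f \<in> S" by blast
    from Union.IH[OF S(1) S(2)] obtain \<phi> where "continuous_map (C_kh X) euclideanreal \<phi>" "\<phi> f = 0"
        "\<phi> ` (topspace (C_kh X) - S) \<subseteq> {1}"
      by blast
    with S(1) show ?case by (intro exI[of _ \<phi>]) blast
  next
    case (plus A V)
    then show ?case by (rule sub_plus_separation)
  next
    case (minus U r)
    then show ?case by (rule sub_minus_separation[OF X D])
  qed
qed

theorem theorem2p5:
  fixes X :: "'a topology"
  assumes "tychonoff_space X"
  shows "(completely_regular_space (C_kh X) \<longleftrightarrow> regular_space (C_kh X)) \<and>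
         (regular_space (C_kh X) \<longleftrightarrow> gdelta_dense_in X (lc X))"
  using completely_regular_imp_regular_space regular_imp_gdelta_dense_lc[OF assms]
    gdelta_dense_lc_imp_completely_regular[OF assms] by blast

end
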